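(* For a given degree-weight generating function $\varphi(t)=\sum_{k\ge 0}\varphi_k t^k$ and a weight function $\rho:\{1,2,3,\dots\}\to\mathbb{R}$, assume that the relation $$\sum_{n\ge 1}\Big(\sum_{T\in\mathcal{T}(n)} w_{\deg}(T)\,w_{\mathrm{hook}}(T)\Big)z^n=F(z)$$ holds, where $w_{\deg}(T)=\prod_{v\in T}\varphi_{d(v)}$, $w_{\mathrm{hook}}(T)=\prod_{v\in T}\rho(h_v)$, and $\mathcal{T}$ is the family of ordered trees, with $\mathcal{T}(n)$ the set of those of size $n$. Then the weight function $\rho$ satisfies $$\rho(n)=\frac{[z^n]F(z)}{[z^{n-1}]\varphi(F(z))},\qquad n\ge 1.$$
   Context: An ordered tree (plane tree) is a finite nonempty rooted tree in which the children of every vertex are linearly ordered; its size is its number of vertices. For a vertex $v$ of a tree $T$, $d(v)$ is its out-degree (number of children), and the hook length $h_v$ is the number of descendants of $v$, where $v$ counts as a descendant of itself. Products over $v\in T$ range over all vertices of $T$. The degree weights $(\varphi_k)_{k\ge 0}$ form a sequence of non-negative real numbers with $\varphi_0>0$ and with $\varphi_k>0$ for at least one $k\ge 2$. The notation $[z^n]A(z)$ denotes the coefficient of $z^n$ in the formal power series $A(z)$.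
   Formalization: The formula for ρ(n) is asserted for exactly those n ≥ 1 with [z^{n-1}]φ(F(z)) ≠ 0; otherwise the quotient is undefined (e.g. φ_0=φ_2=1, other φ_k=0, n=2 gives 0/0 with ρ(2) arbitrary). *)

theory Defs
  imports Complex_Main "HOL-Computational_Algebra.Formal_Power_Series"
begin

datatype ordered_tree = Node "ordered_tree list"

text \<open>
  A vertex is addressed by the path of child indices leading to it from the root, so that
  isomorphic subtrees at different places have different vertices, and \<open>u\<close> is a descendant
  of \<open>v\<close> iff \<open>v\<close> is a (not necessarily proper) prefix of \<open>u\<close>.
\<close>

primrec vertices :: "ordered_tree \<Rightarrow> nat list set" where
  "vertices (Node ts) =
     insert [] (\<Union>i<length ts. (#) i ` (map vertices ts ! i))"

definition tree_size :: "ordered_tree \<Rightarrow> nat" where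
  "tree_size T = card (vertices T)"

definition out_degree :: "ordered_tree \<Rightarrow> nat list \<Rightarrow> nat" where
  "out_degree T v = card {i. v @ [i] \<in> vertices T}"

definition hook_length :: "ordered_tree \<Rightarrow> nat list \<Rightarrow> nat" where
  "hook_length T v = card {u \<in> vertices T. \<exists>w. u = v @ w}"

definition trees_of_size :: "nat \<Rightarrow> ordered_tree set" where
  "trees_of_size n = {T. tree_size T = n}"

definition w_deg :: "(nat \<Rightarrow> real) \<Rightarrow> ordered_tree \<Rightarrow> real" where
  "w_deg \<phi> T = (\<Prod>v\<in>vertices T. \<phi> (out_degree T v))"

definition w_hook :: "(nat \<Rightarrow> real) \<Rightarrow> ordered_tree \<Rightarrow> real" where
  "w_hook \<rho> T = (\<Prod>v\<in>vertices T. \<rho> (hook_length T v))"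

text \<open>
  The products over \<^term>\<open>vertices T\<close> and sums over \<^term>\<open>trees_of_size n\<close> are finite,
  so the conventions for infinite index sets never apply.
\<close>

lemma finite_vertices: "finite (vertices T)"
  by (induction T) auto

lemma tree_size_Node: "tree_size (Node ts) = Suc (sum_list (map tree_size ts))"
proof -
  have "card (\<Union>i<length ts. (#) i ` vertices (ts ! i))
      = (\<Sum>i<length ts. card ((#) i ` vertices (ts ! i)))"
    by (intro card_UN_disjoint) (auto simp: finite_vertices)
  also have "\<dots> = (\<Sum>i<length ts. tree_size (ts ! i))"
    by (simp add: tree_size_def card_image)
  also have "\<dots> = sum_list (map tree_size ts)"
    by (simp add: sum_list_sum_nth atLeast0LessThan)
  finally have *: "card (\<Union>i<length ts. (#) i ` vertices (ts ! i)) = sum_list (map tree_size ts)" .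
  have "tree_size (Node ts) = card (insert [] (\<Union>i<length ts. (#) i ` vertices (ts ! i)))"
    by (simp add: tree_size_def)
  also have "\<dots> = Suc (card (\<Union>i<length ts. (#) i ` vertices (ts ! i)))"
    by (intro card_insert_disjoint) (auto simp: finite_vertices)
  finally show ?thesis using * by simp
qed

lemma tree_size_pos: "tree_size T > 0"
  by (cases T) (simp add: tree_size_Node)

lemma length_le_sum_tree_size: "length ts \<le> sum_list (map tree_size ts)"
proof (induction ts)
  case (Cons t ts)
  then show ?case using tree_size_pos[of t] by simp
qed simp

lemma finite_trees_size_le: "finite {T. tree_size T \<le> n}"
proof (induction n)
  case 0
  have "{T. tree_size T \<le> 0} = {}" by (auto simp: not_le tree_size_pos simp del: le_zero_eq)
  then show ?case by (simp only: finite.emptyI)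
next
  case (Suc n)
  let ?L = "{ts. set ts \<subseteq> {T. tree_size T \<le> n} \<and> length ts \<le> n}"
  have "{T. tree_size T \<le> Suc n} \<subseteq> Node ` ?L"
  proof
    fix T assume T: "T \<in> {T. tree_size T \<le> Suc n}"
    obtain ts where ts: "T = Node ts" by (cases T)
    have s: "sum_list (map tree_size ts) \<le> n" using T ts by (simp add: tree_size_Node)
    have "tree_size t \<le> n" if "t \<in> set ts" for t
      using member_le_sum_list[of "tree_size t" "map tree_size ts"] that s by auto
    moreover have "length ts \<le> n" using length_le_sum_tree_size[of ts] s by simp
    ultimately show "T \<in> Node ` ?L" using ts by auto
  qed
  then show ?case using finite_lists_length_le[OF Suc] finite_subset by blast
qed

lemma finite_trees_of_size: "finite (trees_of_size n)"
  unfolding trees_of_size_def by (rule finite_subset[OF _ finite_trees_size_le[of n]]) auto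

end

theory Submission
  imports Defs
begin

text \<open>
  Cutting off the root turns a tree of size \<open>n\<close> into an ordered forest of total size \<open>n - 1\<close>,
  and the hook length of the root is \<open>n\<close> whatever the tree looks like.  Since out-degrees and hook
  lengths of the other vertices are the same in the tree as in the branch that contains them,
  the weight of a tree with branches \<open>t\<^sub>1, \<dots>, t\<^sub>k\<close> is \<open>\<phi> k * \<rho> n\<close> times the product of the weights
  of the branches (\<open>tree_weight_Node\<close>).  The factor \<open>\<rho> n\<close> is common to all trees of size \<open>n\<close>.
  What remains is a sum over forests, and as the weight of a forest is multiplicative, forests
  with \<open>k\<close> trees are counted by the power \<open>F ^ k\<close> (\<open>power_tree_series_nth\<close>).  Hence
  \<open>[z^n] F = \<rho> n * [z^(n-1)] \<phi>(F)\<close>, and \<open>\<rho> n\<close> is obtained by division.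
\<close>

unbundle fps_syntax

lemma root_in_vertices: "[] \<in> vertices T"
  by (cases T) simp

lemma Cons_in_vertices_Node:
  "i # v \<in> vertices (Node ts) \<longleftrightarrow> i < length ts \<and> v \<in> vertices (ts ! i)"
  by auto

lemma out_degree_root: "out_degree (Node ts) [] = length ts"
  by (simp add: out_degree_def Cons_in_vertices_Node root_in_vertices del: vertices.simps)

lemma out_degree_branch:
  assumes "i < length ts"
  shows "out_degree (Node ts) (i # v) = out_degree (ts ! i) v"
  using assms by (simp add: out_degree_def Cons_in_vertices_Node del: vertices.simps)

lemma hook_length_root: "hook_length T [] = tree_size T"
  by (simp add: hook_length_def tree_size_def)

lemma hook_length_branch:
  assumes "i < length ts"
  shows "hook_length (Node ts) (i # v) = hook_length (ts ! i) v"
proof -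
  have "{u \<in> vertices (Node ts). \<exists>w. u = (i # v) @ w}
      = (#) i ` {u \<in> vertices (ts ! i). \<exists>w. u = v @ w}"
    using assms by auto
  then show ?thesis
    by (simp add: hook_length_def card_image)
qed

lemma prod_vertices_Node:
  fixes g :: "nat list \<Rightarrow> 'a :: comm_monoid_mult"
  shows "(\<Prod>v\<in>vertices (Node ts). g v)
       = g [] * (\<Prod>i<length ts. \<Prod>v\<in>vertices (ts ! i). g (i # v))"
proof -
  let ?B = "\<lambda>i. (#) i ` vertices (ts ! i)"
  have "vertices (Node ts) = insert [] (\<Union>i<length ts. ?B i)"
    by auto
  then have "(\<Prod>v\<in>vertices (Node ts). g v) = g [] * (\<Prod>v\<in>(\<Union>i<length ts. ?B i). g v)"
    by (simp only:) (subst prod.insert; auto simp: finite_vertices)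
  also have "(\<Prod>v\<in>(\<Union>i<length ts. ?B i). g v) = (\<Prod>i<length ts. \<Prod>v\<in>?B i. g v)"
    by (rule prod.UNION_disjoint) (auto simp: finite_vertices)
  finally show ?thesis
    by (simp add: prod.reindex)
qed

definition tree_weight :: "(nat \<Rightarrow> real) \<Rightarrow> (nat \<Rightarrow> real) \<Rightarrow> ordered_tree \<Rightarrow> real" where
  "tree_weight \<phi> \<rho> T = w_deg \<phi> T * w_hook \<rho> T"

text \<open>
  Only the root sees the tree as a whole: descendants of a vertex, and in particular its children,
  lie in the same branch as the vertex.
\<close>

lemma tree_weight_Node:
  "tree_weight \<phi> \<rho> (Node ts)
     = \<phi> (length ts) * \<rho> (tree_size (Node ts)) * prod_list (map (tree_weight \<phi> \<rho>) ts)"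
proof -
  have "prod_list (map (tree_weight \<phi> \<rho>) ts) = (\<Prod>i<length ts. tree_weight \<phi> \<rho> (ts ! i))"
    by (simp add: prod.list_conv_set_nth atLeast0LessThan)
  then show ?thesis
    by (simp add: tree_weight_def w_deg_def w_hook_def prod_vertices_Node out_degree_root
        out_degree_branch hook_length_root hook_length_branch prod.distrib mult_ac
        del: vertices.simps)
qed

definition forests :: "nat \<Rightarrow> nat \<Rightarrow> ordered_tree list set" where
  "forests k n = {ts. length ts = k \<and> sum_list (map tree_size ts) = n}"

lemma trees_of_size_Suc: "trees_of_size (Suc n) = Node ` (\<Union>k\<le>n. forests k n)"
proof -
  have "T \<in> Node ` (\<Union>k\<le>n. forests k n)" if "tree_size T = Suc n" for T
    using that length_le_sum_tree_size by (cases T) (auto simp: forests_def tree_size_Node)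
  then show ?thesis
    by (auto simp: trees_of_size_def forests_def tree_size_Node)
qed

lemma finite_forests: "finite (forests k n)"
proof -
  have "Node ` forests k n \<subseteq> trees_of_size (Suc n)"
    by (auto simp: trees_of_size_def forests_def tree_size_Node)
  then have "finite (Node ` forests k n)"
    using finite_trees_of_size finite_subset by blast
  then show ?thesis
    by (rule finite_imageD) (simp add: inj_on_def)
qed

lemma forests_Suc:
  "forests (Suc k) n
     = (\<lambda>(i, t, ts). t # ts) ` (SIGMA i:{0..n}. trees_of_size i \<times> forests k (n - i))"
proof (intro equalityI subsetI)
  fix us assume "us \<in> forests (Suc k) n"
  then obtain t ts where "us = t # ts" "length ts = k"
    "tree_size t + sum_list (map tree_size ts) = n"
    by (auto simp: forests_def length_Suc_conv)
  then show "us \<in> (\<lambda>(i, t, ts). t # ts) ` (SIGMA i:{0..n}. trees_of_size i \<times> forests k (n - i))"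
    by (intro image_eqI[of _ _ "(tree_size t, t, ts)"]) (auto simp: forests_def trees_of_size_def)
qed (auto simp: forests_def trees_of_size_def)

text \<open>
  The coefficient of a product of series is a convolution, which here splits the total size of a
  forest between its first tree and the remaining ones.
\<close>

lemma power_tree_series_nth:
  fixes W :: "ordered_tree \<Rightarrow> 'a :: comm_ring_1"
  shows "(Abs_fps (\<lambda>n. \<Sum>T\<in>trees_of_size n. W T) ^ k) $ n
       = (\<Sum>ts\<in>forests k n. prod_list (map W ts))"
proof (induction k arbitrary: n)
  case 0
  have "forests 0 n = (if n = 0 then {[]} else {})"
    by (auto simp: forests_def)
  then show ?case
    by simp
next
  case (Suc k)
  let ?S = "SIGMA i:{0..n}. trees_of_size i \<times> forests k (n - i)"
  have inj: "inj_on (\<lambda>(i, t, ts). t # ts) ?S"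
    by (auto simp: inj_on_def trees_of_size_def)
  have "(\<Sum>us\<in>forests (Suc k) n. prod_list (map W us))
      = (\<Sum>(i, t, ts)\<in>?S. W t * prod_list (map W ts))"
    unfolding forests_Suc sum.reindex[OF inj] by (simp add: case_prod_unfold)
  also have "\<dots> = (\<Sum>i=0..n. \<Sum>(t, ts)\<in>trees_of_size i \<times> forests k (n - i).
                    W t * prod_list (map W ts))"
    by (subst sum.Sigma) (auto simp: finite_trees_of_size finite_forests)
  also have "\<dots> = (\<Sum>i=0..n. (\<Sum>t\<in>trees_of_size i. W t)
                    * (\<Sum>ts\<in>forests k (n - i). prod_list (map W ts)))"
    by (simp add: sum_product sum.cartesian_product)
  finally show ?case
    by (simp add: fps_mult_nth Suc.IH)
qed

text \<open>
  Grouping the trees by root degree gives the coefficientwise form of the functional equation;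
  for \<open>\<rho> = 1\<close> it is the equation \<open>F(z) = z * \<phi>(F(z))\<close> of simply generated trees.
\<close>

lemma tree_series_nth_Suc:
  fixes \<phi> \<rho> :: "nat \<Rightarrow> real"
  defines "F \<equiv> Abs_fps (\<lambda>n. \<Sum>T\<in>trees_of_size n. tree_weight \<phi> \<rho> T)"
  shows "F $ Suc n = \<rho> (Suc n) * (Abs_fps \<phi> oo F) $ n"
proof -
  let ?W = "tree_weight \<phi> \<rho>"
  have "F $ Suc n = (\<Sum>ts\<in>(\<Union>k\<le>n. forests k n). ?W (Node ts))"
    by (simp add: F_def trees_of_size_Suc sum.reindex inj_on_def)
  also have "\<dots> = (\<Sum>k\<le>n. \<Sum>ts\<in>forests k n. ?W (Node ts))"
    by (rule sum.UNION_disjoint) (auto simp: finite_forests, auto simp: forests_def)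
  also have "\<dots> = (\<Sum>k\<le>n. \<Sum>ts\<in>forests k n. \<rho> (Suc n) * (\<phi> k * prod_list (map ?W ts)))"
    by (intro sum.cong) (auto simp: forests_def tree_weight_Node tree_size_Node)
  also have "\<dots> = \<rho> (Suc n) * (\<Sum>k\<le>n. \<phi> k * (F ^ k) $ n)"
    by (simp add: F_def power_tree_series_nth sum_distrib_left)
  finally show ?thesis
    by (simp add: fps_compose_nth atLeast0AtMost)
qed

theorem theorem1:
  fixes \<phi> :: "nat \<Rightarrow> real" and \<rho> :: "nat \<Rightarrow> real" and F :: "real fps"
  assumes "\<And>k. \<phi> k \<ge> 0"
    and "\<phi> 0 > 0"
    and "\<exists>k\<ge>2. \<phi> k > 0"
    and "Abs_fps (\<lambda>n. if n \<ge> 1 then \<Sum>T\<in>trees_of_size n. w_deg \<phi> T * w_hook \<rho> T else 0) = F"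
  shows "\<forall>n\<ge>1. fps_nth (fps_compose (Abs_fps \<phi>) F) (n - 1) \<noteq> 0 \<longrightarrow>
           \<rho> n = fps_nth F n / fps_nth (fps_compose (Abs_fps \<phi>) F) (n - 1)"
proof (intro allI impI)
  fix n :: nat
  assume n: "n \<ge> 1" and nz: "(Abs_fps \<phi> oo F) $ (n - 1) \<noteq> 0"
  have "trees_of_size 0 = {}"
    using tree_size_pos by (auto simp: trees_of_size_def)
  then have F: "F = Abs_fps (\<lambda>n. \<Sum>T\<in>trees_of_size n. tree_weight \<phi> \<rho> T)"
    unfolding assms(4)[symmetric] by (auto simp: fps_eq_iff tree_weight_def not_le)
  from n obtain m where "n = Suc m"
    by (cases n) auto
  then have "F $ n = \<rho> n * (Abs_fps \<phi> oo F) $ (n - 1)"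
    using tree_series_nth_Suc[of \<phi> \<rho> m] F by simp
  with nz show "\<rho> n = F $ n / (Abs_fps \<phi> oo F) $ (n - 1)"
    by simp
qed

end
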